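(* Let $\beta>0$. Consider the four route set measures $\mathcal{M}(\mathcal{R})=\mathcal{E}(\mathcal{R},\boldsymbol{p}(\mathcal{R}))$ obtained by combining a routing $\boldsymbol{p}\in\{\boldsymbol{p}^{sp},\boldsymbol{p}^{logit}\}$ with an evaluation function $\mathcal{E}\in\{\mathcal{E}_{tt},\mathcal{E}_{ptt}\}$. Then: (i) shortest path routing with travel time evaluation $(\boldsymbol{p}^{sp},\mathcal{E}_{tt})$ is monotonic (but not strictly monotonic) and consistent; (ii) logit routing with travel time evaluation $(\boldsymbol{p}^{logit},\mathcal{E}_{tt})$ is neither monotonic nor consistent; (iii) shortest path routing with perceived travel time evaluation $(\boldsymbol{p}^{sp},\mathcal{E}_{ptt})$ is monotonic (but not strictly monotonic) and not consistent; (iv) logit routing with perceived travel time evaluation $(\boldsymbol{p}^{logit},\mathcal{E}_{ptt})$ is strictly monotonic and consistent.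
   Context: A route set is a finite nonempty set $\mathcal{R}=\{1,\dots,n\}$ of routes with durations $l_i\in\mathbb{R}$. Let $\mathcal{P}$ be the set of probability vectors indexed by $\mathcal{R}$. A routing assigns to each route set $\mathcal{R}$ a vector $\boldsymbol{p}(\mathcal{R})\in\mathcal{P}$. Shortest path routing: $p^{sp}_i=1$ if $i$ is the route of minimum duration (ties broken by lowest index) and $p_i^{sp}=0$ otherwise. Logit routing with parameter $\beta>0$: $p_i^{logit}=e^{-\beta l_i}/\sum_{j\in\mathcal{R}}e^{-\beta l_j}$. Evaluation functions, for $p\in\mathcal{P}$: travel time $\mathcal{E}_{tt}(\mathcal{R},p)=\sum_{i\in\mathcal{R}} l_ip_i$; perceived travel time $\mathcal{E}_{ptt}(\mathcal{R},p)=\sum_{i\in\mathcal{R}} l_ip_i+\frac1\beta\sum_{i\in\mathcal{R}} p_i\log p_i$ (same $\beta$, convention $0\log 0=0$). Partial order on route sets: given $\mathcal{R},\mathcal{R}'$ with duration vectors $l,l'$, sort $l$ and $l'$ in increasing order and append entries $+\infty$ so that they have the same length. Write $\mathcal{R}\preceq\mathcal{R}'$ if $l\le l'$ elementwise, and $\mathcal{R}\prec\mathcal{R}'$ if additionally $l\ne l'$ (for the sorted, padded vectors). A measure $\mathcal{M}$ is monotonic if $\mathcal{R}\preceq\mathcal{R}'$ implies $\mathcal{M}(\mathcal{R})\le\mathcal{M}(\mathcal{R}')$ for all route sets $\mathcal{R},\mathcal{R}'$; it is strictly monotonic if additionally $\mathcal{R}\prec\mathcal{R}'$ implies $\mathcal{M}(\mathcal{R})<\mathcal{M}(\mathcal{R}')$.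 A measure combining $\boldsymbol{p}$ and $\mathcal{E}$ is consistent if, for every route set $\mathcal{R}$, $\boldsymbol{p}(\mathcal{R})$ is an optimal solution of $\min_{p\in\mathcal{P}}\mathcal{E}(\mathcal{R},p)$. *)

theory Defs
  imports "HOL-Analysis.Analysis"
begin

text \<open>
  A route set is given by the nonempty list of the durations of its routes; the routes
  themselves are the positions in this list, counted from 0.
\<close>

definition route_set :: "real list \<Rightarrow> bool" where
  "route_set l \<longleftrightarrow> l \<noteq> []"

definition routes :: "real list \<Rightarrow> nat set" where
  "routes l = {..<length l}"

text \<open>
  Vectors indexed by the routes are functions on \<^typ>\<open>nat\<close> vanishing outside the routes, so
  that each vector has exactly one representation.
\<close>

definition prob_vectors :: "real list \<Rightarrow> (nat \<Rightarrow> real) set" where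
  "prob_vectors l =
     {p. (\<forall>i\<in>routes l. 0 \<le> p i) \<and> (\<forall>i. i \<notin> routes l \<longrightarrow> p i = 0) \<and> (\<Sum>i\<in>routes l. p i) = 1}"

type_synonym routing = "real list \<Rightarrow> nat \<Rightarrow> real"
type_synonym evaluation = "real list \<Rightarrow> (nat \<Rightarrow> real) \<Rightarrow> real"

definition is_routing :: "routing \<Rightarrow> bool" where
  "is_routing p \<longleftrightarrow> (\<forall>l. route_set l \<longrightarrow> p l \<in> prob_vectors l)"

definition shortest_route :: "real list \<Rightarrow> nat" where
  "shortest_route l = (LEAST i. i \<in> routes l \<and> (\<forall>j\<in>routes l. l ! i \<le> l ! j))"

definition p_sp :: routing where
  "p_sp l i = (if i = shortest_route l then 1 else 0)"

definition p_logit :: "real \<Rightarrow> routing" where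
  "p_logit \<beta> l i =
     (if i \<in> routes l then exp (- \<beta> * l ! i) / (\<Sum>j\<in>routes l. exp (- \<beta> * l ! j)) else 0)"

definition E_tt :: evaluation where
  "E_tt l p = (\<Sum>i\<in>routes l. l ! i * p i)"

definition E_ptt :: "real \<Rightarrow> evaluation" where
  "E_ptt \<beta> l p =
     (\<Sum>i\<in>routes l. l ! i * p i) +
     1 / \<beta> * (\<Sum>i\<in>routes l. if p i = 0 then 0 else p i * ln (p i))"

definition sorted_padded :: "nat \<Rightarrow> real list \<Rightarrow> ereal list" where
  "sorted_padded m l = map ereal (sort l) @ replicate (m - length l) \<infinity>"

definition route_le :: "real list \<Rightarrow> real list \<Rightarrow> bool" where
  "route_le l l' \<longleftrightarrow>
     (let m = max (length l) (length l')
      in list_all2 (\<le>) (sorted_padded m l) (sorted_padded m l'))"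

definition route_less :: "real list \<Rightarrow> real list \<Rightarrow> bool" where
  "route_less l l' \<longleftrightarrow>
     route_le l l' \<and>
     (let m = max (length l) (length l') in sorted_padded m l \<noteq> sorted_padded m l')"

definition route_measure :: "routing \<Rightarrow> evaluation \<Rightarrow> real list \<Rightarrow> real" where
  "route_measure p E l = E l (p l)"

definition monotonic :: "(real list \<Rightarrow> real) \<Rightarrow> bool" where
  "monotonic M \<longleftrightarrow>
     (\<forall>l l'. route_set l \<longrightarrow> route_set l' \<longrightarrow> route_le l l' \<longrightarrow> M l \<le> M l')"

definition strictly_monotonic :: "(real list \<Rightarrow> real) \<Rightarrow> bool" where
  "strictly_monotonic M \<longleftrightarrow>
     monotonic M \<and>
     (\<forall>l l'. route_set l \<longrightarrow> route_set l' \<longrightarrow> route_less l l' \<longrightarrow> M l < M l')"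

definition consistent :: "routing \<Rightarrow> evaluation \<Rightarrow> bool" where
  "consistent p E \<longleftrightarrow>
     (\<forall>l. route_set l \<longrightarrow> is_arg_min (E l) (\<lambda>q. q \<in> prob_vectors l) (p l))"

lemma shortest_route:
  assumes "route_set l"
  shows "shortest_route l \<in> routes l" "\<And>j. j \<in> routes l \<Longrightarrow> l ! shortest_route l \<le> l ! j"
proof -
  have fin: "finite (routes l)" and ne: "routes l \<noteq> {}"
    using assms by (auto simp: routes_def route_set_def)
  let ?i = "arg_min_on (\<lambda>j. l ! j) (routes l)"
  have "?i \<in> routes l \<and> (\<forall>j\<in>routes l. l ! ?i \<le> l ! j)"
    using arg_min_if_finite(1)[OF fin ne] arg_min_least[OF fin ne] by blast
  then have "shortest_route l \<in> routes l \<and> (\<forall>j\<in>routes l. l ! shortest_route l \<le> l ! j)"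
    unfolding shortest_route_def by (rule LeastI)
  then show "shortest_route l \<in> routes l"
    "\<And>j. j \<in> routes l \<Longrightarrow> l ! shortest_route l \<le> l ! j" by auto
qed

lemma is_routing_p_sp: "is_routing p_sp"
  unfolding is_routing_def
proof (intro allI impI)
  fix l assume "route_set l"
  then have "shortest_route l \<in> routes l" by (rule shortest_route)
  then show "p_sp l \<in> prob_vectors l"
    by (auto simp: prob_vectors_def p_sp_def routes_def)
qed

lemma is_routing_p_logit: "is_routing (p_logit \<beta>)"
  unfolding is_routing_def
proof (intro allI impI)
  fix l assume "route_set l"
  then have "(\<Sum>j\<in>routes l. exp (- \<beta> * l ! j)) > 0"
    by (intro sum_pos) (auto simp: routes_def route_set_def)
  then show "p_logit \<beta> l \<in> prob_vectors l"
    by (auto simp: prob_vectors_def p_logit_def simp flip: sum_divide_distrib)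
qed

end

theory Submission
  imports Defs
begin

text \<open>
  Under shortest path routing no entropy is produced, so both evaluations return the smallest
  duration, which is the first entry of the sorted vector and hence monotonic; putting all mass on a
  shortest route minimises the linear functional \<^const>\<open>E_tt\<close>.

  The perceived travel time is, up to the factor \<open>1 / \<beta>\<close>, the Gibbs free energy of a system with
  energies \<open>l\<close>. With the partition function \<open>Z = (\<Sum>i. exp (- \<beta> * l\<^sub>i))\<close> it equals
  \<open>- ln Z / \<beta>\<close> plus \<open>1 / \<beta>\<close> times the relative entropy of \<open>p\<close> with respect to the logit
  distribution. As relative entropy is nonnegative (lemma \<open>E_ptt_ge_free_energy\<close>), the logit
  distribution is optimal and its value is the log-sum-exp \<open>- ln Z / \<beta>\<close>
  (lemma \<open>E_ptt_logit\<close>). The order on route sets amounts to a comparison of the sorted vectors up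
  to the shorter length (lemma \<open>route_le_iff\<close>), so passing to a smaller route set increases
  summands of \<open>Z\<close> or adds positive ones. This makes \<open>Z\<close> strictly antitone, and the log-sum-exp
  strictly monotonic.

  All negative claims are witnessed by the one pair \<open>[0, 1] \<prec> [0]\<close>. Adding a slower route
  leaves the shortest duration at 0, whereas the logit routing diverts some traffic to the slower
  route: this makes the travel time positive, and the perceived travel time negative.
\<close>

section \<open>The order on route sets\<close>

text \<open>
  An entry \<open>\<infinity>\<close> of the padded smaller vector can only be dominated by \<open>\<infinity>\<close>, so the smaller route set
  has at least as many routes; beyond the length of the larger one the comparison is with \<open>\<infinity>\<close>.
\<close>

lemma route_le_iff:
  "route_le l l' \<longleftrightarrow>
     length l' \<le> length l \<and> (\<forall>i<length l'. sort l ! i \<le> sort l' ! i)"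
proof
  assume le: "route_le l l'"
  define m where "m = max (length l) (length l')"
  have nth: "sorted_padded m l ! i \<le> sorted_padded m l' ! i" if "i < m" for i
    using le that by (auto simp: route_le_def m_def Let_def list_all2_conv_all_nth sorted_padded_def)
  have len: "length l' \<le> length l"
  proof (rule ccontr)
    assume "\<not> length l' \<le> length l"
    with nth[of "length l"] show False
      by (simp add: sorted_padded_def nth_append m_def)
  qed
  moreover have "sort l ! i \<le> sort l' ! i" if "i < length l'" for i
    using nth[of i] that len by (simp add: sorted_padded_def nth_append m_def)
  ultimately show "length l' \<le> length l \<and> (\<forall>i<length l'. sort l ! i \<le> sort l' ! i)"
    by blast
next
  assume "length l' \<le> length l \<and> (\<forall>i<length l'. sort l ! i \<le> sort l' ! i)"
  then show "route_le l l'"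
    by (auto simp: route_le_def Let_def list_all2_conv_all_nth sorted_padded_def nth_append max_def)
qed

lemma route_less_iff:
  "route_less l l' \<longleftrightarrow> route_le l l' \<and> sort l \<noteq> sort l'"
proof (cases "route_le l l'")
  case True
  then have "length l' \<le> length l"
    by (simp add: route_le_iff)
  then have "route_less l l' \<longleftrightarrow>
      map ereal (sort l) \<noteq> map ereal (sort l') @ replicate (length l - length l') \<infinity>"
    using True by (simp add: route_less_def Let_def sorted_padded_def max_absorb1)
  also have "\<dots> \<longleftrightarrow> sort l \<noteq> sort l'"
  proof (cases "length l = length l'")
    case True
    then show ?thesis by (simp add: inj_map_eq_map inj_on_def)
  next
    case False
    have "sort l \<noteq> sort l'"
      using False by (metis length_sort)
    moreover have "map ereal (sort l) ! length l'
        \<noteq> (map ereal (sort l') @ replicate (length l - length l') \<infinity>) ! length l'"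
      using False \<open>length l' \<le> length l\<close> by (simp add: nth_append)
    ultimately show ?thesis by metis
  qed
  finally show ?thesis using True by simp
qed (simp add: route_less_def)

section \<open>Shortest path routing\<close>

lemma E_tt_p_sp:
  assumes "route_set l"
  shows "E_tt l (p_sp l) = l ! shortest_route l"
proof -
  have "E_tt l (p_sp l) = (\<Sum>i\<in>routes l. if i = shortest_route l then l ! i else 0)"
    unfolding E_tt_def p_sp_def by (intro sum.cong) auto
  also have "\<dots> = l ! shortest_route l"
    using shortest_route(1)[OF assms] by (simp add: routes_def)
  finally show ?thesis .
qed

lemma E_ptt_p_sp: "E_ptt \<beta> l (p_sp l) = E_tt l (p_sp l)"
proof -
  have "(\<Sum>i\<in>routes l. if p_sp l i = 0 then 0 else p_sp l i * ln (p_sp l i)) = 0"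
    by (intro sum.neutral) (auto simp: p_sp_def)
  then show ?thesis by (simp only: E_ptt_def E_tt_def mult_zero_right add_0_right)
qed

lemma nth_shortest_route:
  assumes "route_set l"
  shows "l ! shortest_route l = sort l ! 0"
proof (rule antisym)
  have mem: "sort l ! 0 \<in> set l"
    using assms nth_mem[of 0 "sort l"] by (simp add: route_set_def)
  then obtain j where "j \<in> routes l" "l ! j = sort l ! 0"
    by (auto simp: in_set_conv_nth routes_def)
  then show "l ! shortest_route l \<le> sort l ! 0"
    using shortest_route(2)[OF assms] by metis
  have "l ! shortest_route l \<in> set (sort l)"
    using shortest_route(1)[OF assms] by (simp add: routes_def)
  then obtain i where "i < length (sort l)" "sort l ! i = l ! shortest_route l"
    by (auto simp only: in_set_conv_nth)
  then show "sort l ! 0 \<le> l ! shortest_route l"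
    using sorted_nth_mono[of "sort l" 0 i] by simp
qed

lemma monotonic_sp_tt: "monotonic (route_measure p_sp E_tt)"
  by (simp add: monotonic_def route_measure_def E_tt_p_sp nth_shortest_route route_le_iff route_set_def)

lemma consistent_sp_tt: "consistent p_sp E_tt"
proof -
  have "l ! shortest_route l \<le> E_tt l p" if l: "route_set l" and p: "p \<in> prob_vectors l" for l p
  proof -
    have "l ! shortest_route l = (\<Sum>i\<in>routes l. l ! shortest_route l * p i)"
      using p by (simp add: prob_vectors_def flip: sum_distrib_left)
    also have "\<dots> \<le> E_tt l p"
      unfolding E_tt_def using p shortest_route(2)[OF l]
      by (intro sum_mono mult_right_mono) (auto simp: prob_vectors_def)
    finally show ?thesis .
  qed
  then show ?thesis
    using is_routing_p_sp
    by (auto simp: consistent_def is_arg_min_def is_routing_def E_tt_p_sp not_less)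
qed

section \<open>The partition function and perceived travel time\<close>

definition partition_function :: "real \<Rightarrow> real list \<Rightarrow> real" where
  "partition_function \<beta> l = (\<Sum>i\<in>routes l. exp (- \<beta> * l ! i))"

lemma partition_function_pos: "route_set l \<Longrightarrow> 0 < partition_function \<beta> l"
  unfolding partition_function_def
  by (intro sum_pos) (auto simp: routes_def route_set_def)

lemma partition_function_sort: "partition_function \<beta> (sort l) = partition_function \<beta> l"
proof -
  have *: "partition_function \<beta> xs = (\<Sum>x\<in>#mset xs. exp (- \<beta> * x))" for xs
  proof -
    have "partition_function \<beta> xs = (\<Sum>x\<leftarrow>xs. exp (- \<beta> * x))"
      by (simp add: partition_function_def routes_def sum_list_sum_nth atLeast0LessThan)
    then show ?thesis by (metis mset_map sum_mset_sum_list)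
  qed
  show ?thesis by (simp only: * mset_sort)
qed

lemma partition_function_antimono:
  assumes "\<beta> > 0" "route_le l l'"
  shows "partition_function \<beta> l' \<le> partition_function \<beta> l"
proof -
  have "(\<Sum>i<length l'. exp (- \<beta> * sort l' ! i)) \<le> (\<Sum>i<length l'. exp (- \<beta> * sort l ! i))"
    using assms by (intro sum_mono) (auto simp: route_le_iff)
  also have "\<dots> \<le> (\<Sum>i<length l. exp (- \<beta> * sort l ! i))"
    using assms by (intro sum_mono2) (auto simp: route_le_iff)
  finally show ?thesis
    by (subst (1 2) partition_function_sort[symmetric])
      (simp add: partition_function_def routes_def)
qed

text \<open>
  The inequality is strict for one of two reasons: an additional route contributes a positive
  summand, or, among equally many routes, one of the sorted durations is smaller.
\<close>

lemma partition_function_strict_antimono: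
  assumes "\<beta> > 0" "route_less l l'"
  shows "partition_function \<beta> l' < partition_function \<beta> l"
proof -
  have len: "length l' \<le> length l" and le: "\<And>i. i < length l' \<Longrightarrow> sort l ! i \<le> sort l' ! i"
    and ne: "sort l \<noteq> sort l'"
    using assms by (auto simp: route_less_iff route_le_iff)
  have "(\<Sum>i<length l'. exp (- \<beta> * sort l' ! i)) < (\<Sum>i<length l. exp (- \<beta> * sort l ! i))"
  proof (cases "length l' = length l")
    case True
    with ne obtain i where "i < length l'" "sort l ! i \<noteq> sort l' ! i"
      by (metis length_sort nth_equalityI)
    with le[of i] have "\<exists>i\<in>{..<length l'}. exp (- \<beta> * sort l' ! i) < exp (- \<beta> * sort l ! i)"
      using assms(1) by (intro bexI[of _ i]) auto
    then show ?thesis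
      using True le assms(1) by (auto intro!: sum_strict_mono_ex1)
  next
    case False
    have "(\<Sum>i<length l'. exp (- \<beta> * sort l' ! i)) \<le> (\<Sum>i<length l'. exp (- \<beta> * sort l ! i))"
      using le assms(1) by (intro sum_mono) auto
    also have "\<dots> < (\<Sum>i<length l. exp (- \<beta> * sort l ! i))"
      using len False by (intro sum_strict_mono2[where b = "length l'"]) auto
    finally show ?thesis .
  qed
  then show ?thesis
    by (subst (1 2) partition_function_sort[symmetric])
      (simp add: partition_function_def routes_def)
qed

lemma E_ptt_logit:
  assumes "\<beta> > 0" "route_set l"
  shows "E_ptt \<beta> l (p_logit \<beta> l) = - ln (partition_function \<beta> l) / \<beta>"
proof -
  let ?Z = "partition_function \<beta> l" and ?q = "p_logit \<beta> l"
  have Z: "?Z > 0" by (rule partition_function_pos[OF assms(2)])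
  have q: "?q i = exp (- \<beta> * l ! i) / ?Z" if "i \<in> routes l" for i
    using that by (simp add: p_logit_def partition_function_def)
  have "E_ptt \<beta> l ?q = (\<Sum>i\<in>routes l. l ! i * ?q i + 1 / \<beta> * (?q i * ln (?q i)))"
    unfolding E_ptt_def sum_distrib_left sum.distrib[symmetric] by (intro sum.cong) auto
  also have "\<dots> = (\<Sum>i\<in>routes l. - ln ?Z / \<beta> * ?q i)"
  proof (intro sum.cong refl)
    fix i assume "i \<in> routes l"
    then have ln_q: "ln (?q i) = - \<beta> * l ! i - ln ?Z"
      using Z by (simp add: q ln_div)
    have "l ! i + ln (?q i) / \<beta> = - ln ?Z / \<beta>"
      unfolding ln_q using assms(1) by (simp add: diff_divide_distrib)
    moreover have "l ! i * ?q i + 1 / \<beta> * (?q i * ln (?q i)) = (l ! i + ln (?q i) / \<beta>) * ?q i"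
      by (simp add: algebra_simps)
    ultimately show "l ! i * ?q i + 1 / \<beta> * (?q i * ln (?q i)) = - ln ?Z / \<beta> * ?q i"
      by simp
  qed
  also have "\<dots> = - ln ?Z / \<beta> * (\<Sum>i\<in>routes l. ?q i)"
    by (simp only: sum_distrib_left)
  also have "\<dots> = - ln ?Z / \<beta>"
    using is_routing_p_logit[of \<beta>] assms(2)
    by (simp add: is_routing_def prob_vectors_def)
  finally show ?thesis .
qed

text \<open>
  This is Gibbs' inequality: with \<open>q\<close> the logit distribution, \<open>ln x \<le> x - 1\<close> at \<open>x = q\<^sub>i / p\<^sub>i\<close>
  bounds each summand of the relative entropy of \<open>p\<close> with respect to \<open>q\<close> from below by
  \<open>p\<^sub>i - q\<^sub>i\<close>, and these bounds sum to 0.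
\<close>

lemma E_ptt_ge_free_energy:
  assumes "\<beta> > 0" "route_set l" "p \<in> prob_vectors l"
  shows "- ln (partition_function \<beta> l) / \<beta> \<le> E_ptt \<beta> l p"
proof -
  let ?Z = "partition_function \<beta> l" and ?q = "p_logit \<beta> l"
  have Z: "?Z > 0" by (rule partition_function_pos[OF assms(2)])
  have "?q \<in> prob_vectors l"
    using is_routing_p_logit assms(2) by (auto simp: is_routing_def)
  then have "- ln ?Z / \<beta> = - ln ?Z / \<beta> * (\<Sum>i\<in>routes l. p i)
      + 1 / \<beta> * ((\<Sum>i\<in>routes l. p i) - (\<Sum>i\<in>routes l. ?q i))"
    using assms(3) by (simp add: prob_vectors_def)
  also have "\<dots> = (\<Sum>i\<in>routes l. - ln ?Z / \<beta> * p i + 1 / \<beta> * (p i - ?q i))"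
    by (simp only: sum.distrib sum_distrib_left[symmetric] sum_subtractf)
  also have "\<dots> \<le> (\<Sum>i\<in>routes l. l ! i * p i + 1 / \<beta> * (if p i = 0 then 0 else p i * ln (p i)))"
  proof (rule sum_mono)
    fix i assume i: "i \<in> routes l"
    have q: "?q i = exp (- \<beta> * l ! i) / ?Z"
      using i by (simp add: p_logit_def partition_function_def)
    show "- ln ?Z / \<beta> * p i + 1 / \<beta> * (p i - ?q i)
        \<le> l ! i * p i + 1 / \<beta> * (if p i = 0 then 0 else p i * ln (p i))"
    proof (cases "p i = 0")
      case True
      then show ?thesis using Z assms(1) by (simp add: q)
    next
      case False
      with assms(3) i have p: "p i > 0"
        by (force simp: prob_vectors_def)
      have "ln (?q i / p i) \<le> ?q i / p i - 1"
        using p Z by (intro ln_le_minus_one) (simp add: q)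
      moreover have "ln (?q i / p i) = - \<beta> * l ! i - ln ?Z - ln (p i)"
        using p Z by (simp add: q ln_div ln_mult)
      ultimately have "p i * (- \<beta> * l ! i - ln ?Z - ln (p i)) \<le> p i * (?q i / p i - 1)"
        using p by (intro mult_left_mono) auto
      then have "- ln ?Z * p i + (p i - ?q i) \<le> \<beta> * (l ! i * p i) + p i * ln (p i)"
        using p by (simp add: algebra_simps)
      then have "(- ln ?Z * p i + (p i - ?q i)) / \<beta> \<le> (\<beta> * (l ! i * p i) + p i * ln (p i)) / \<beta>"
        using assms(1) by (intro divide_right_mono) auto
      then show ?thesis
        using False assms(1) by (simp add: add_divide_distrib diff_divide_distrib)
    qed
  qed
  also have "\<dots> = E_ptt \<beta> l p"
    by (simp add: E_ptt_def sum.distrib sum_distrib_left)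
  finally show ?thesis .
qed

lemma consistent_logit_ptt:
  assumes "\<beta> > 0"
  shows "consistent (p_logit \<beta>) (E_ptt \<beta>)"
  using is_routing_p_logit E_ptt_ge_free_energy[OF assms]
  by (auto simp: consistent_def is_arg_min_def is_routing_def E_ptt_logit[OF assms] not_less)

lemma strictly_monotonic_logit_ptt:
  assumes "\<beta> > 0"
  shows "strictly_monotonic (route_measure (p_logit \<beta>) (E_ptt \<beta>))"
  using assms partition_function_pos
  by (auto simp: strictly_monotonic_def monotonic_def route_measure_def E_ptt_logit
      divide_right_mono divide_strict_right_mono partition_function_antimono
      partition_function_strict_antimono)

section \<open>Adding a slower route\<close>

lemma E_tt_logit_01: "E_tt [0, 1] (p_logit \<beta> [0, 1]) > 0"
proof -
  have "routes [0, 1] = {0, Suc 0}"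
    by (auto simp: routes_def)
  then show ?thesis
    by (simp add: E_tt_def p_logit_def add_pos_pos)
qed

lemma E_tt_logit_0: "E_tt [0] (p_logit \<beta> [0]) = 0"
  by (simp add: E_tt_def routes_def)

lemma E_ptt_logit_01:
  assumes "\<beta> > 0"
  shows "E_ptt \<beta> [0, 1] (p_logit \<beta> [0, 1]) < 0"
proof -
  have "routes [0, 1] = {0, Suc 0}"
    by (auto simp: routes_def)
  then have "partition_function \<beta> [0, 1] > 1"
    by (simp add: partition_function_def)
  then show ?thesis
    using assms by (simp add: E_ptt_logit route_set_def)
qed

lemma E_tt_sp_01: "E_tt [0, 1] (p_sp [0, 1]) = 0"
  and E_tt_sp_0: "E_tt [0] (p_sp [0]) = 0"
  by (simp_all add: E_tt_p_sp nth_shortest_route route_set_def)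

lemma route_less_01: "route_less [0, 1] [0]"
  by (simp add: route_less_iff route_le_iff)

theorem mainTheorem1:
  fixes \<beta> :: real
  assumes "\<beta> > 0"
  shows
    "(monotonic (route_measure p_sp E_tt) \<and>
      \<not> strictly_monotonic (route_measure p_sp E_tt) \<and>
      consistent p_sp E_tt) \<and>
     (\<not> monotonic (route_measure (p_logit \<beta>) E_tt) \<and>
      \<not> consistent (p_logit \<beta>) E_tt) \<and>
     (monotonic (route_measure p_sp (E_ptt \<beta>)) \<and>
      \<not> strictly_monotonic (route_measure p_sp (E_ptt \<beta>)) \<and>
      \<not> consistent p_sp (E_ptt \<beta>)) \<and>
     (strictly_monotonic (route_measure (p_logit \<beta>) (E_ptt \<beta>)) \<and>
      consistent (p_logit \<beta>) (E_ptt \<beta>))"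
proof -
  have sp_eq: "route_measure p_sp (E_ptt \<beta>) = route_measure p_sp E_tt"
    by (simp add: fun_eq_iff route_measure_def E_ptt_p_sp)
  have rs: "route_set [0, 1]" "route_set [0]"
    by (simp_all add: route_set_def)
  have le: "route_le [0, 1] [0]"
    using route_less_01 by (simp add: route_less_def)
  have mem: "p_sp [0, 1] \<in> prob_vectors [0, 1]" "p_logit \<beta> [0, 1] \<in> prob_vectors [0, 1]"
    using is_routing_p_sp is_routing_p_logit rs by (auto simp: is_routing_def)
  have "\<not> strictly_monotonic (route_measure p_sp E_tt)"
  proof
    assume "strictly_monotonic (route_measure p_sp E_tt)"
    with rs route_less_01 have "route_measure p_sp E_tt [0, 1] < route_measure p_sp E_tt [0]"
      unfolding strictly_monotonic_def by blast
    then show False by (simp add: route_measure_def E_tt_sp_01[simplified] E_tt_sp_0)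
  qed
  moreover have "\<not> monotonic (route_measure (p_logit \<beta>) E_tt)"
  proof
    assume "monotonic (route_measure (p_logit \<beta>) E_tt)"
    with rs le have "route_measure (p_logit \<beta>) E_tt [0, 1] \<le> route_measure (p_logit \<beta>) E_tt [0]"
      unfolding monotonic_def by blast
    then show False
      using E_tt_logit_01[of \<beta>] by (simp add: route_measure_def E_tt_logit_0)
  qed
  moreover have "\<not> consistent (p_logit \<beta>) E_tt"
  proof
    assume "consistent (p_logit \<beta>) E_tt"
    with rs mem have "\<not> E_tt [0, 1] (p_sp [0, 1]) < E_tt [0, 1] (p_logit \<beta> [0, 1])"
      unfolding consistent_def is_arg_min_def by blast
    then show False
      using E_tt_logit_01[of \<beta>] E_tt_sp_01 by simp
  qed
  moreover have "\<not> consistent p_sp (E_ptt \<beta>)"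
  proof
    assume "consistent p_sp (E_ptt \<beta>)"
    with rs mem have "\<not> E_ptt \<beta> [0, 1] (p_logit \<beta> [0, 1]) < E_ptt \<beta> [0, 1] (p_sp [0, 1])"
      unfolding consistent_def is_arg_min_def by blast
    then show False
      using E_ptt_logit_01[OF assms] E_tt_sp_01 by (simp add: E_ptt_p_sp)
  qed
  ultimately show ?thesis
    using monotonic_sp_tt consistent_sp_tt consistent_logit_ptt[OF assms]
      strictly_monotonic_logit_ptt[OF assms]
    by (simp add: sp_eq)
qed

end
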